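(* Let $\mathcal{L}\in\mathcal{M}(N)$, $\mathcal{T}\in\mathcal{A}(N)$, let $\mathbb{A}=(\phi,\delta)$ abstract $(\mathcal{L},\mathcal{T})$, let $(\mathcal{T},\mathbb{A})\models\mathsf{AxCmpl}$ with witness $t_{acc}$, and suppose $\mathbb{A}$ is finitary. For every state $p$ of $\mathcal{L}$, trace $s\in\mathsf{Act}^*$ and $E\subseteq X$, if $p\Downarrow s$ then either (i) Must$\big(p,\ t_{acc}(\overline{s},\ \bigcup[\![p]\!](s)\setminus E)\big)$, or (ii) there exists $\widehat{R}\in[\![p]\!](s)$ with $\widehat{R}\subseteq E$. Here $\overline{s}$ is $s$ with every action replaced by its dual.
   Context: $\mathsf{Act}$ countable set of visible actions, $\tau\notin\mathsf{Act}$, $\mathsf{L}=\mathsf{Act}\cup\{\tau\}$, involutive duality $\mu\mapsto\overline{\mu}$; $N\subseteq\mathsf{Act}$ non-blocking, $B=\mathsf{Act}\setminus N$; LTSs finite-image. Axioms (all $\alpha\in\mathsf{L}$, $\eta\in N$, $\mu\in\mathsf{Act}$, $\mu\ne\eta$): N-delay: $p_1\xrightarrow{\eta}p_2\xrightarrow{\alpha}p_3\Rightarrow\exists p_4.\,p_1\xrightarrow{\alpha}p_4\xrightarrow{\eta}p_3$; N-confluence: $p_1\xrightarrow{\eta}p_2,p_1\xrightarrow{\mu}p_3\Rightarrow\exists p_4.\,p_2\xrightarrow{\mu}p_4,p_3\xrightarrow{\eta}p_4$; N-determinacy: $p_1\xrightarrow{\eta}p_2,p_1\xrightarrow{\eta}p_3\Rightarrow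 p_2=p_3$; backwards-N-determinacy: $p_2\xrightarrow{\eta}p_1,p_3\xrightarrow{\eta}p_1\Rightarrow p_2=p_3$; Fwd-Feedback: $p_1\xrightarrow{\eta}p_2\xrightarrow{\overline{\eta}}p_3\Rightarrow p_1\xrightarrow{\tau}p_3$ or $p_1=p_3$; Boomerang: each $p$ has $p'$ with $p\xrightarrow{\overline{\eta}}p'\xrightarrow{\eta}p$; N-tau: $p_1\xrightarrow{\eta}p_2,p_1\xrightarrow{\tau}p_3$ imply $\exists p_4.\,p_2\xrightarrow{\tau}p_4,p_3\xrightarrow{\eta}p_4$, or $p_2\xrightarrow{\overline{\eta}}p_3$; Feedback: $p\xrightarrow{\eta}q\xrightarrow{\overline{\eta}}q'\Rightarrow p\xrightarrow{\tau}q'$. $\mathcal{M}(N)$: LTSs with N-delay, N-confluence, N-determinacy, backwards-N-determinacy, Fwd-Feedback, Boomerang, N-tau. $\mathcal{A}(N)$: LTSs with N-delay, N-confluence, N-determinacy, backwards-N-determinacy, N-tau, Feedback. Composition of $p$ and test $t$: steps by $\tau$-moves of either side or by $p\xrightarrow{\overline{\mu}}p'$, $t\xrightarrow{\mu}t'$. good: decidable predicate on tests preserved in both directions by $N$-transitions. Must$(p,t)$ iff every maximal computation from $(p,t)$ contains a state with good test. $p\Downarrow s$: no state reached via a weak transition along a prefix of $s$ has an infinite $\tau$-sequence. $\mathrm{ws}(p,s)=\{q:p\overset{s}{\Rightarrow}q\not\xrightarrow{\tau}\}$. $R(t)=\{\mu:t\xrightarrow{\mu}\}$, $\mathrm{coR}(p)=\{\beta\in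 B:p\xrightarrow{\overline{\beta}}\}$. Label abstraction $\mathbb{A}=(\phi:B\to Y,\delta:Y\to X)$, $\mathrm{coR}_{\mathbb{A}}(p)=\{\delta(\phi(\beta)):\beta\in\mathrm{coR}(p)\}$; finitary if every $\mathrm{coR}_{\mathbb{A}}(p)$ is finite; abstracts $(\mathcal{L},\mathcal{T})$ if for all $\beta,\beta'\in B$: (i) for each test $t$, $\phi(\beta)=\phi(\beta')$, $\beta\in R(t)\Rightarrow\beta'\in R(t)$; (ii) for each $p$ in $\mathcal{L}$, $\delta(\phi(\beta))=\delta(\phi(\beta'))$, $\phi(\beta)\in\phi(\mathrm{coR}(p))\Rightarrow\phi(\beta')\in\phi(\mathrm{coR}(p))$. $[\![p]\!](s)=\{\mathrm{coR}_{\mathbb{A}}(q):q\in\mathrm{ws}(p,s)\}$ (defined when $p\Downarrow s$). $(\mathcal{T},\mathbb{A})\models\mathsf{AxCmpl}$: there are $t_{cnv}:\mathsf{Act}^*\to T$, $t_{acc}:\mathsf{Act}^*\times\mathcal{P}_{fin}(X)\to T$ such that for all $s$, $\mu,\mu'\in\mathsf{Act}$, finite $E\subseteq X$, $f\in\{t_{cnv},t_{acc}(\cdot,E)\}$: (1) not good$(f(s))$; (2) $f(\mu.s)\xrightarrow{\mu}f(s)$; (3) $\mu\in B\Rightarrow f(\mu.s)\xrightarrow{\tau}$; (4) $\mu\in B$, $f(\mu.s)\xrightarrow{\tau}t\Rightarrow$ good$(t)$; (5) $\mu\in B$, $f(\mu.s)\xrightarrow{\mu}t\Rightarrow t=f(s)$;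 (6) $\mu\in B$, $f(\mu.s)\xrightarrow{\mu'}t$, $\mu'\ne\mu\Rightarrow$ good$(t)$; (a1) $t_{acc}(\varepsilon,E)\not\xrightarrow{\tau}$; (a2) $t_{acc}(\varepsilon,E)\not\xrightarrow{\eta}$, $\eta\in N$; (a3) $\beta\in B$, $t_{acc}(\varepsilon,E)\xrightarrow{\beta}\Rightarrow\delta(\phi(\beta))\in E$; (a4) each $e\in E$ is $\delta(\phi(\beta))$ for some $\beta\in B$ with $t_{acc}(\varepsilon,E)\xrightarrow{\beta}$; (a5) $\beta\in B$, $t_{acc}(\varepsilon,E)\xrightarrow{\beta}t\Rightarrow$ good$(t)$; (c1) $t_{cnv}(\varepsilon)\not\xrightarrow{\mu}$, $\mu\in\mathsf{Act}$; (c2) $t_{cnv}(\varepsilon)\xrightarrow{\tau}$; (c3) $t_{cnv}(\varepsilon)\xrightarrow{\tau}t\Rightarrow$ good$(t)$. *)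

theory Defs
  imports Main "HOL-Library.Countable" "HOL-Library.Sublist"
    "HOL-Library.Extended_Nat" "HOL-Library.FuncSet"
begin

text \<open>The type \<open>'a\<close> is the set of visible actions; labels are visible actions or \<open>Tau\<close>.\<close>

datatype 'a label = Vis 'a | Tau

type_synonym ('p, 'a) lts = "'p \<Rightarrow> 'a label \<Rightarrow> 'p \<Rightarrow> bool"

definition can_do :: "('p, 'a) lts \<Rightarrow> 'p \<Rightarrow> 'a label \<Rightarrow> bool" where
  "can_do tr p \<alpha> \<longleftrightarrow> (\<exists>q. tr p \<alpha> q)"

definition finite_image :: "('p, 'a) lts \<Rightarrow> bool" where
  "finite_image tr \<longleftrightarrow> (\<forall>p \<alpha>. finite {q. tr p \<alpha> q})"

definition involutive :: "('a \<Rightarrow> 'a) \<Rightarrow> bool" where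
  "involutive dual \<longleftrightarrow> (\<forall>\<mu>. dual (dual \<mu>) = \<mu>)"

definition N_delay :: "'a set \<Rightarrow> ('p, 'a) lts \<Rightarrow> bool" where
  "N_delay N tr \<longleftrightarrow> (\<forall>\<eta>\<in>N. \<forall>\<alpha> p1 p2 p3. tr p1 (Vis \<eta>) p2 \<and> tr p2 \<alpha> p3 \<longrightarrow>
     (\<exists>p4. tr p1 \<alpha> p4 \<and> tr p4 (Vis \<eta>) p3))"

definition N_confluence :: "'a set \<Rightarrow> ('p, 'a) lts \<Rightarrow> bool" where
  "N_confluence N tr \<longleftrightarrow> (\<forall>\<eta>\<in>N. \<forall>\<mu> p1 p2 p3. \<mu> \<noteq> \<eta> \<and> tr p1 (Vis \<eta>) p2 \<and> tr p1 (Vis \<mu>) p3 \<longrightarrow>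
     (\<exists>p4. tr p2 (Vis \<mu>) p4 \<and> tr p3 (Vis \<eta>) p4))"

definition N_determinacy :: "'a set \<Rightarrow> ('p, 'a) lts \<Rightarrow> bool" where
  "N_determinacy N tr \<longleftrightarrow> (\<forall>\<eta>\<in>N. \<forall>p1 p2 p3. tr p1 (Vis \<eta>) p2 \<and> tr p1 (Vis \<eta>) p3 \<longrightarrow> p2 = p3)"

definition backwards_N_determinacy :: "'a set \<Rightarrow> ('p, 'a) lts \<Rightarrow> bool" where
  "backwards_N_determinacy N tr \<longleftrightarrow>
     (\<forall>\<eta>\<in>N. \<forall>p1 p2 p3. tr p2 (Vis \<eta>) p1 \<and> tr p3 (Vis \<eta>) p1 \<longrightarrow> p2 = p3)"

definition Fwd_Feedback :: "('a \<Rightarrow> 'a) \<Rightarrow> 'a set \<Rightarrow> ('p, 'a) lts \<Rightarrow> bool" where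
  "Fwd_Feedback dual N tr \<longleftrightarrow>
     (\<forall>\<eta>\<in>N. \<forall>p1 p2 p3. tr p1 (Vis \<eta>) p2 \<and> tr p2 (Vis (dual \<eta>)) p3 \<longrightarrow> tr p1 Tau p3 \<or> p1 = p3)"

definition Boomerang :: "('a \<Rightarrow> 'a) \<Rightarrow> 'a set \<Rightarrow> ('p, 'a) lts \<Rightarrow> bool" where
  "Boomerang dual N tr \<longleftrightarrow>
     (\<forall>\<eta>\<in>N. \<forall>p. \<exists>p'. tr p (Vis (dual \<eta>)) p' \<and> tr p' (Vis \<eta>) p)"

definition N_tau :: "('a \<Rightarrow> 'a) \<Rightarrow> 'a set \<Rightarrow> ('p, 'a) lts \<Rightarrow> bool" where
  "N_tau dual N tr \<longleftrightarrow> (\<forall>\<eta>\<in>N. \<forall>p1 p2 p3. tr p1 (Vis \<eta>) p2 \<and> tr p1 Tau p3 \<longrightarrow>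
     (\<exists>p4. tr p2 Tau p4 \<and> tr p3 (Vis \<eta>) p4) \<or> tr p2 (Vis (dual \<eta>)) p3)"

definition Feedback :: "('a \<Rightarrow> 'a) \<Rightarrow> 'a set \<Rightarrow> ('p, 'a) lts \<Rightarrow> bool" where
  "Feedback dual N tr \<longleftrightarrow>
     (\<forall>\<eta>\<in>N. \<forall>p q q'. tr p (Vis \<eta>) q \<and> tr q (Vis (dual \<eta>)) q' \<longrightarrow> tr p Tau q')"

text \<open>The classes \<open>\<M>(N)\<close> and \<open>\<A>(N)\<close>; all LTSs are finite-image.\<close>

definition class_M :: "('a \<Rightarrow> 'a) \<Rightarrow> 'a set \<Rightarrow> ('p, 'a) lts \<Rightarrow> bool" where
  "class_M dual N tr \<longleftrightarrow> finite_image tr \<and>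
     N_delay N tr \<and> N_confluence N tr \<and> N_determinacy N tr \<and> backwards_N_determinacy N tr \<and>
     Fwd_Feedback dual N tr \<and> Boomerang dual N tr \<and> N_tau dual N tr"

definition class_A :: "('a \<Rightarrow> 'a) \<Rightarrow> 'a set \<Rightarrow> ('p, 'a) lts \<Rightarrow> bool" where
  "class_A dual N tr \<longleftrightarrow> finite_image tr \<and>
     N_delay N tr \<and> N_confluence N tr \<and> N_determinacy N tr \<and> backwards_N_determinacy N tr \<and>
     N_tau dual N tr \<and> Feedback dual N tr"

definition good_preserved :: "'a set \<Rightarrow> ('t, 'a) lts \<Rightarrow> ('t \<Rightarrow> bool) \<Rightarrow> bool" where
  "good_preserved N trT good \<longleftrightarrow> (\<forall>\<eta>\<in>N. \<forall>t t'. trT t (Vis \<eta>) t' \<longrightarrow> (good t \<longleftrightarrow> good t'))"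

inductive comp_step ::
  "('a \<Rightarrow> 'a) \<Rightarrow> ('p, 'a) lts \<Rightarrow> ('t, 'a) lts \<Rightarrow> 'p \<times> 't \<Rightarrow> 'p \<times> 't \<Rightarrow> bool"
  for dual trL trT where
  left: "trL p Tau p' \<Longrightarrow> comp_step dual trL trT (p, t) (p', t)"
| right: "trT t Tau t' \<Longrightarrow> comp_step dual trL trT (p, t) (p, t')"
| comm: "trL p (Vis (dual \<mu>)) p' \<Longrightarrow> trT t (Vis \<mu>) t' \<Longrightarrow>
    comp_step dual trL trT (p, t) (p', t')"

text \<open>A computation with \<open>n\<close> steps (possibly \<open>n = \<infinity>\<close>) consists of the states \<open>c i\<close> with
  \<open>enat i \<le> n\<close>; the values of \<open>c\<close> beyond \<open>n\<close> are irrelevant.\<close>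

definition maximal_computation :: "('s \<Rightarrow> 's \<Rightarrow> bool) \<Rightarrow> (nat \<Rightarrow> 's) \<Rightarrow> enat \<Rightarrow> bool" where
  "maximal_computation step c n \<longleftrightarrow>
     (\<forall>i. enat i < n \<longrightarrow> step (c i) (c (Suc i))) \<and>
     (\<forall>k. n = enat k \<longrightarrow> \<not> (\<exists>x. step (c k) x))"

definition Must ::
  "('a \<Rightarrow> 'a) \<Rightarrow> ('p, 'a) lts \<Rightarrow> ('t, 'a) lts \<Rightarrow> ('t \<Rightarrow> bool) \<Rightarrow> 'p \<Rightarrow> 't \<Rightarrow> bool" where
  "Must dual trL trT good p t \<longleftrightarrow>
     (\<forall>c n. c 0 = (p, t) \<and> maximal_computation (comp_step dual trL trT) c n \<longrightarrow>
        (\<exists>i. enat i \<le> n \<and> good (snd (c i))))"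

inductive weak :: "('p, 'a) lts \<Rightarrow> 'p \<Rightarrow> 'a list \<Rightarrow> 'p \<Rightarrow> bool" for tr where
  refl: "weak tr p [] p"
| tau: "tr p Tau q \<Longrightarrow> weak tr q s r \<Longrightarrow> weak tr p s r"
| vis: "tr p (Vis \<mu>) q \<Longrightarrow> weak tr q s r \<Longrightarrow> weak tr p (\<mu> # s) r"

definition diverges :: "('p, 'a) lts \<Rightarrow> 'p \<Rightarrow> bool" where
  "diverges tr p \<longleftrightarrow> (\<exists>f. f (0::nat) = p \<and> (\<forall>i. tr (f i) Tau (f (Suc i))))"

definition converges :: "('p, 'a) lts \<Rightarrow> 'p \<Rightarrow> 'a list \<Rightarrow> bool" where
  "converges tr p s \<longleftrightarrow> (\<forall>s' q. prefix s' s \<and> weak tr p s' q \<longrightarrow> \<not> diverges tr q)"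

definition ws :: "('p, 'a) lts \<Rightarrow> 'p \<Rightarrow> 'a list \<Rightarrow> 'p set" where
  "ws tr p s = {q. weak tr p s q \<and> \<not> can_do tr q Tau}"

definition R :: "('t, 'a) lts \<Rightarrow> 't \<Rightarrow> 'a set" where
  "R trT t = {\<mu>. can_do trT t (Vis \<mu>)}"

text \<open>The set \<open>B\<close> of blocking actions is the complement \<open>- N\<close>.\<close>

definition coR :: "('a \<Rightarrow> 'a) \<Rightarrow> 'a set \<Rightarrow> ('p, 'a) lts \<Rightarrow> 'p \<Rightarrow> 'a set" where
  "coR dual N tr p = {\<beta> \<in> - N. can_do tr p (Vis (dual \<beta>))}"

text \<open>The codomains \<open>Y\<close> and \<open>X\<close> are explicit carrier sets, since they may be empty when
  every action is non-blocking; \<open>\<phi>\<close> is only meaningful on \<open>- N\<close> and \<open>\<delta>\<close> on \<open>Y\<close>.\<close>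

definition label_abstraction ::
  "'a set \<Rightarrow> 'y set \<Rightarrow> 'x set \<Rightarrow> ('a \<Rightarrow> 'y) \<Rightarrow> ('y \<Rightarrow> 'x) \<Rightarrow> bool" where
  "label_abstraction N Y X \<phi> \<delta> \<longleftrightarrow> \<phi> \<in> (- N) \<rightarrow> Y \<and> \<delta> \<in> Y \<rightarrow> X"

definition coR_abs ::
  "('a \<Rightarrow> 'a) \<Rightarrow> 'a set \<Rightarrow> ('a \<Rightarrow> 'y) \<Rightarrow> ('y \<Rightarrow> 'x) \<Rightarrow> ('p, 'a) lts \<Rightarrow> 'p \<Rightarrow> 'x set" where
  "coR_abs dual N \<phi> \<delta> tr p = {\<delta> (\<phi> \<beta>) | \<beta>. \<beta> \<in> coR dual N tr p}"

definition finitary ::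
  "('a \<Rightarrow> 'a) \<Rightarrow> 'a set \<Rightarrow> ('a \<Rightarrow> 'y) \<Rightarrow> ('y \<Rightarrow> 'x) \<Rightarrow> ('p, 'a) lts \<Rightarrow> bool" where
  "finitary dual N \<phi> \<delta> tr \<longleftrightarrow> (\<forall>p. finite (coR_abs dual N \<phi> \<delta> tr p))"

definition abstracts ::
  "('a \<Rightarrow> 'a) \<Rightarrow> 'a set \<Rightarrow> ('a \<Rightarrow> 'y) \<Rightarrow> ('y \<Rightarrow> 'x) \<Rightarrow> ('p, 'a) lts \<Rightarrow> ('t, 'a) lts \<Rightarrow> bool" where
  "abstracts dual N \<phi> \<delta> trL trT \<longleftrightarrow> (\<forall>\<beta>\<in>- N. \<forall>\<beta>'\<in>- N.
     (\<forall>t. \<phi> \<beta> = \<phi> \<beta>' \<and> \<beta> \<in> R trT t \<longrightarrow> \<beta>' \<in> R trT t) \<and>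
     (\<forall>p. \<delta> (\<phi> \<beta>) = \<delta> (\<phi> \<beta>') \<and> \<phi> \<beta> \<in> \<phi> ` coR dual N trL p \<longrightarrow>
        \<phi> \<beta>' \<in> \<phi> ` coR dual N trL p))"

text \<open>The semantics \<open>\<lbrakk>p\<rbrakk>(s)\<close>; it is meant to be used only when \<open>p\<close> converges along \<open>s\<close>.\<close>

definition sem ::
  "('a \<Rightarrow> 'a) \<Rightarrow> 'a set \<Rightarrow> ('a \<Rightarrow> 'y) \<Rightarrow> ('y \<Rightarrow> 'x) \<Rightarrow> ('p, 'a) lts \<Rightarrow> 'p \<Rightarrow> 'a list \<Rightarrow> 'x set set" where
  "sem dual N \<phi> \<delta> tr p s = {coR_abs dual N \<phi> \<delta> tr q | q. q \<in> ws tr p s}"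

definition ax_gen :: "'a set \<Rightarrow> ('t, 'a) lts \<Rightarrow> ('t \<Rightarrow> bool) \<Rightarrow> ('a list \<Rightarrow> 't) \<Rightarrow> bool" where
  "ax_gen N trT good f \<longleftrightarrow>
     (\<forall>s. \<not> good (f s)) \<and>
     (\<forall>s \<mu>. trT (f (\<mu> # s)) (Vis \<mu>) (f s)) \<and>
     (\<forall>s. \<forall>\<mu>\<in>- N. can_do trT (f (\<mu> # s)) Tau) \<and>
     (\<forall>s t. \<forall>\<mu>\<in>- N. trT (f (\<mu> # s)) Tau t \<longrightarrow> good t) \<and>
     (\<forall>s t. \<forall>\<mu>\<in>- N. trT (f (\<mu> # s)) (Vis \<mu>) t \<longrightarrow> t = f s) \<and>
     (\<forall>s t \<mu>'. \<forall>\<mu>\<in>- N. trT (f (\<mu> # s)) (Vis \<mu>') t \<and> \<mu>' \<noteq> \<mu> \<longrightarrow> good t)"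

definition ax_acc ::
  "'a set \<Rightarrow> ('a \<Rightarrow> 'y) \<Rightarrow> ('y \<Rightarrow> 'x) \<Rightarrow> ('t, 'a) lts \<Rightarrow> ('t \<Rightarrow> bool) \<Rightarrow> 't \<Rightarrow> 'x set \<Rightarrow> bool" where
  "ax_acc N \<phi> \<delta> trT good t0 E \<longleftrightarrow>
     \<not> can_do trT t0 Tau \<and>
     (\<forall>\<eta>\<in>N. \<not> can_do trT t0 (Vis \<eta>)) \<and>
     (\<forall>\<beta>\<in>- N. can_do trT t0 (Vis \<beta>) \<longrightarrow> \<delta> (\<phi> \<beta>) \<in> E) \<and>
     (\<forall>e\<in>E. \<exists>\<beta>\<in>- N. e = \<delta> (\<phi> \<beta>) \<and> can_do trT t0 (Vis \<beta>)) \<and>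
     (\<forall>\<beta>\<in>- N. \<forall>t. trT t0 (Vis \<beta>) t \<longrightarrow> good t)"

definition ax_cnv :: "('t, 'a) lts \<Rightarrow> ('t \<Rightarrow> bool) \<Rightarrow> 't \<Rightarrow> bool" where
  "ax_cnv trT good t0 \<longleftrightarrow>
     (\<forall>\<mu>. \<not> can_do trT t0 (Vis \<mu>)) \<and> can_do trT t0 Tau \<and> (\<forall>t. trT t0 Tau t \<longrightarrow> good t)"

text \<open>\<open>t_acc s E\<close> is constrained only for finite \<open>E \<subseteq> X\<close>, i.e. it is a function on
  \<open>Act\<^sup>* \<times> \<P>\<^sub>f\<^sub>i\<^sub>n(X)\<close>.\<close>

definition AxCmpl_witness ::
  "'a set \<Rightarrow> 'x set \<Rightarrow> ('a \<Rightarrow> 'y) \<Rightarrow> ('y \<Rightarrow> 'x) \<Rightarrow> ('t, 'a) lts \<Rightarrow> ('t \<Rightarrow> bool) \<Rightarrow>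
   ('a list \<Rightarrow> 't) \<Rightarrow> ('a list \<Rightarrow> 'x set \<Rightarrow> 't) \<Rightarrow> bool" where
  "AxCmpl_witness N X \<phi> \<delta> trT good t_cnv t_acc \<longleftrightarrow>
     ax_gen N trT good t_cnv \<and> ax_cnv trT good (t_cnv []) \<and>
     (\<forall>E. finite E \<and> E \<subseteq> X \<longrightarrow>
        ax_gen N trT good (\<lambda>s. t_acc s E) \<and> ax_acc N \<phi> \<delta> trT good (t_acc [] E) E)"

end

theory Submission
  imports Defs
begin

text \<open>Write \<open>F\<close> for \<open>\<Union>\<lbrakk>p\<rbrakk>(s) - E\<close>, which is finite by Koenig's lemma. If (ii) fails, every stable
  state reached by \<open>p\<close> along \<open>s\<close> offers some label in \<open>F\<close>, and passing \<open>t_acc\<close> follows by induction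
  on \<open>s\<close> and, for a fixed \<open>s\<close>, on the well-founded \<open>\<tau>\<close>-steps of \<open>p\<close>. For a blocking head action the
  axioms of \<open>t_acc\<close> determine all moves of the test. For a non-blocking head action \<open>\<eta>\<close> they do not;
  here Boomerang lets \<open>p\<close> absorb \<open>\<eta>\<close>, reaching a state \<open>p'\<close> that still holds \<open>\<eta>\<close> and returns to \<open>p\<close>
  by emitting it, and passing a test does not depend on whether \<open>\<eta>\<close> is pending in the process or
  in the test.\<close>

section \<open>Must-testing as a least fixed point\<close>

text \<open>This form allows rule induction in place of reasoning about maximal computations. The
  first premise of \<open>later\<close> excludes deadlock before success.\<close>

inductive passes ::
  "('a \<Rightarrow> 'a) \<Rightarrow> ('p, 'a) lts \<Rightarrow> ('t, 'a) lts \<Rightarrow> ('t \<Rightarrow> bool) \<Rightarrow> 'p \<times> 't \<Rightarrow> bool"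
  for dual trL trT good where
  now: "good (snd c) \<Longrightarrow> passes dual trL trT good c"
| later: "\<exists>c'. comp_step dual trL trT c c' \<Longrightarrow>
    (\<And>c'. comp_step dual trL trT c c' \<Longrightarrow> passes dual trL trT good c') \<Longrightarrow>
    passes dual trL trT good c"

text \<open>The position \<open>j\<close> is arbitrary because the induction advances along
  \<open>c\<close>: at a \<open>later\<close> state the computation cannot end, and its next state
  passes again.\<close>

lemma passes_computation:
  assumes "passes dual trL trT good x" "c j = x" "enat j \<le> n"
    and "maximal_computation (comp_step dual trL trT) c n"
  shows "\<exists>i. enat i \<le> n \<and> good (snd (c i))"
  using assms
proof (induction arbitrary: j rule: passes.induct)
  case (now x)
  then show ?case by blast
next
  case (later x)
  have "n \<noteq> enat j"
    using later.hyps(1) later.prems by (auto simp: maximal_computation_def)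
  then have less: "enat j < n"
    using later.prems(2) by auto
  then have "comp_step dual trL trT x (c (Suc j))"
    using later.prems by (auto simp: maximal_computation_def)
  moreover have "enat (Suc j) \<le> n"
    using less by (simp add: Suc_ile_eq)
  ultimately show ?case
    using later.IH later.prems(3) by blast
qed

lemma passes_imp_Must:
  "passes dual trL trT good (p, t) \<Longrightarrow> Must dual trL trT good p t"
  unfolding Must_def by (auto intro: passes_computation[where j = 0] simp: enat_0)

section \<open>Convergence and Koenig's lemma\<close>

text \<open>A counterexample to \<open>P\<close> has a \<tau>-successor that is one too; dependent
  choice chains these into a divergence.\<close>

lemma not_diverges_induct [consumes 1, case_names step]:
  assumes "\<not> diverges tr p"
    and step: "\<And>p. (\<And>q. tr p Tau q \<Longrightarrow> P q) \<Longrightarrow> P p"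
  shows "P p"
proof (rule ccontr)
  assume "\<not> P p"
  moreover have "\<exists>q. tr x Tau q \<and> \<not> P q" if "\<not> P x" for x
    using step that by blast
  \<comment> \<open>The clause \<open>n = 0 \<longrightarrow> x = p\<close> pins the start of the
    chosen sequence.\<close>
  ultimately have "\<exists>f. f (0::nat) = p \<and> (\<forall>i. \<not> P (f i) \<and> tr (f i) Tau (f (Suc i)))"
    using dependent_nat_choice[of "\<lambda>n x. \<not> P x \<and> (n = 0 \<longrightarrow> x = p)" "\<lambda>n x y. tr x Tau y"]
    by auto
  then show False
    using assms(1) by (auto simp: diverges_def)
qed

lemma converges_imp_not_diverges: "converges tr p s \<Longrightarrow> \<not> diverges tr p"
  unfolding converges_def by (metis Nil_prefix weak.refl)

lemma converges_tau: "converges tr p s \<Longrightarrow> tr p Tau q \<Longrightarrow> converges tr q s"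
  unfolding converges_def using weak.tau by metis

lemma converges_vis: "converges tr p (\<mu> # s) \<Longrightarrow> tr p (Vis \<mu>) q \<Longrightarrow> converges tr q s"
  unfolding converges_def using weak.vis by (metis Cons_prefix_Cons)

text \<open>Lexicographic: induction on the trace, and inside it on the \<tau>-steps, well-founded
  by convergence.\<close>

lemma converges_induct [consumes 1, case_names step]:
  assumes "converges tr p s"
    and step: "\<And>p s. converges tr p s \<Longrightarrow> (\<And>q. tr p Tau q \<Longrightarrow> P q s) \<Longrightarrow>
      (\<And>\<mu> s' q. s = \<mu> # s' \<Longrightarrow> tr p (Vis \<mu>) q \<Longrightarrow> P q s') \<Longrightarrow> P p s"
  shows "P p s"
  using assms(1)
proof (induction s arbitrary: p)
  case Nil
  from converges_imp_not_diverges[OF Nil] Nil show ?case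
  proof (induction rule: not_diverges_induct)
    case (step p)
    show ?case
      by (rule assms(2)[OF step.prems]) (auto intro: step.IH converges_tau[OF step.prems])
  qed
next
  case (Cons \<mu> s)
  from converges_imp_not_diverges[OF Cons.prems] Cons.prems show ?case
  proof (induction rule: not_diverges_induct)
    case (step p)
    show ?case
      by (rule assms(2)[OF step.prems])
        (auto intro: step.IH Cons.IH converges_tau[OF step.prems] converges_vis[OF step.prems])
  qed
qed

lemma finite_weak:
  assumes "finite_image tr" "converges tr p s"
  shows "finite {q. weak tr p s q}"
  using assms(2)
proof (induction rule: converges_induct)
  case (step p s)
  have fin: "finite {q. tr p \<alpha> q}" for \<alpha>
    using assms(1) by (simp add: finite_image_def)
  \<comment> \<open>A weak transition is empty or starts with one of finitely many steps. The guard
    \<open>s \<noteq> []\<close> empties the last union where \<open>hd s\<close> is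
    unspecified.\<close>
  have "{q. weak tr p s q} \<subseteq> insert p ((\<Union>r\<in>{r. tr p Tau r}. {q. weak tr r s q}) \<union>
      (\<Union>r\<in>{r. s \<noteq> [] \<and> tr p (Vis (hd s)) r}. {q. weak tr r (tl s) q}))"
  proof
    fix q
    assume "q \<in> {q. weak tr p s q}"
    then have "weak tr p s q" by simp
    then show "q \<in> insert p ((\<Union>r\<in>{r. tr p Tau r}. {q. weak tr r s q}) \<union>
        (\<Union>r\<in>{r. s \<noteq> [] \<and> tr p (Vis (hd s)) r}. {q. weak tr r (tl s) q}))"
      by cases auto
  qed
  moreover have "finite (\<Union>r\<in>{r. tr p Tau r}. {q. weak tr r s q})"
    using fin step.IH(1) by blast
  moreover have "finite (\<Union>r\<in>{r. s \<noteq> [] \<and> tr p (Vis (hd s)) r}. {q. weak tr r (tl s) q})"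
    using fin step.IH(2)[of "hd s" "tl s"] by (cases "s = []") auto
  ultimately show ?case
    by (meson finite_UnI finite_insert finite_subset)
qed

lemma ws_tau: "tr p Tau q \<Longrightarrow> ws tr q s \<subseteq> ws tr p s"
  by (auto simp: ws_def intro: weak.tau)

lemma ws_vis: "tr p (Vis \<mu>) q \<Longrightarrow> ws tr q s \<subseteq> ws tr p (\<mu> # s)"
  by (auto simp: ws_def intro: weak.vis)

section \<open>Messages pending in the process or in the test\<close>

text \<open>The message \<eta> is held by the process in \<open>(p', t')\<close> and by the test in
  \<open>(p, t)\<close>. At most one step of \<open>(p', t')\<close> matches each step of
  \<open>(p, t)\<close>; afterwards the pairs are related in the same way or coincide.\<close>

lemma passes_move_message:
  assumes dual: "involutive dual" and M: "class_M dual N trL" and A: "class_A dual N trT"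
    and good: "good_preserved N trT good" and \<eta>: "\<eta> \<in> N"
    and "passes dual trL trT good (p', t')" "trL p' (Vis \<eta>) p" "trT t (Vis \<eta>) t'"
  shows "passes dual trL trT good (p, t)"
proof -
  have Ldelay: "N_delay N trL" and boomerang: "Boomerang dual N trL"
    and feedback: "Fwd_Feedback dual N trL"
    using M by (simp_all add: class_M_def)
  have Ttau: "N_tau dual N trT" and Tdet: "N_determinacy N trT" and Tconf: "N_confluence N trT"
    using A by (simp_all add: class_A_def)
  from assms(6-8) show ?thesis
  proof (induction "(p', t')" arbitrary: p' t' p t rule: passes.induct)
    case now
    then have "good t"
      using good \<eta> by (auto simp: good_preserved_def)
    then show ?case by (auto intro: passes.now)
  next
    case (later p' t')
    note p' = \<open>trL p' (Vis \<eta>) p\<close> and t = \<open>trT t (Vis \<eta>) t'\<close>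
    have delay: "\<exists>q'. trL p' \<alpha> q' \<and> trL q' (Vis \<eta>) q" if "trL p \<alpha> q" for \<alpha> q
      using Ldelay \<eta> p' that unfolding N_delay_def by blast
    have self: "passes dual trL trT good (p', t')"
      using later.hyps by (auto intro: passes.later)
    \<comment> \<open>Every process can receive \<eta>, so a test holding it is never stuck.\<close>
    have "\<exists>c. comp_step dual trL trT (p, t) c"
      using boomerang \<eta> t unfolding Boomerang_def by (meson comp_step.comm)
    moreover have "passes dual trL trT good c" if "comp_step dual trL trT (p, t) c" for c
      using that
    proof (cases rule: comp_step.cases)
      case (left q)
      obtain q' where "trL p' Tau q'" "trL q' (Vis \<eta>) q"
        using delay left(2) by blast
      then show ?thesis
        using later.hyps(3)[OF comp_step.left _ t] left(1) by simp
    next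
      case (right u)
      \<comment> \<open>In the second case \<open>t\<close> consumed its own \<eta>;
        \<open>t'\<close> can receive it from \<open>p'\<close> instead, which gives the same pair
        \<open>(p, u)\<close>.\<close>
      consider v where "trT t' Tau v" "trT u (Vis \<eta>) v" | "trT t' (Vis (dual \<eta>)) u"
        using Ttau \<eta> t right(2) unfolding N_tau_def by blast
      then show ?thesis
      proof cases
        case 1
        then show ?thesis
          using later.hyps(3)[OF comp_step.right p'] right(1) by simp
      next
        case 2
        have "trL p' (Vis (dual (dual \<eta>))) p"
          using dual p' by (simp add: involutive_def)
        then show ?thesis
          using later.hyps(2)[OF comp_step.comm] right(1) 2 by simp
      qed
    next
      case (comm \<nu> q u)
      show ?thesis
      proof (cases "\<nu> = \<eta>")
        case True
        have "u = t'"
          using Tdet \<eta> t comm(3) True unfolding N_determinacy_def by blast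
        \<comment> \<open>Sending \<eta> and receiving it back costs \<open>p'\<close> at most one
          \<tau>-step.\<close>
        moreover have "trL p' Tau q \<or> p' = q"
          using feedback \<eta> p' comm(2) True unfolding Fwd_Feedback_def by blast
        ultimately show ?thesis
          using self later.hyps(2)[OF comp_step.left] comm(1) by auto
      next
        case False
        obtain v where "trT t' (Vis \<nu>) v" "trT u (Vis \<eta>) v"
          using Tconf \<eta> t comm(3) False unfolding N_confluence_def by blast
        moreover obtain q' where "trL p' (Vis (dual \<nu>)) q'" "trL q' (Vis \<eta>) q"
          using delay comm(2) by blast
        ultimately show ?thesis
          using later.hyps(3)[OF comp_step.comm] comm(1) by simp
      qed
    qed
    ultimately show ?case by (rule passes.later)
  qed
qed

section \<open>Passing the acceptance tests\<close>

text \<open>Process and test may share only the abstract label \<open>e\<close>. The second clause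
  of \<open>abstracts\<close> lifts this to agreement under \<phi>, the first to a common
  action.\<close>

lemma abstract_offer_synchronises:
  assumes abs: "abstracts dual N \<phi> \<delta> trL trT" and acc: "ax_acc N \<phi> \<delta> trT good t F"
    and "e \<in> coR_abs dual N \<phi> \<delta> trL p" "e \<in> F"
  shows "\<exists>c. comp_step dual trL trT (p, t) c"
proof -
  obtain \<beta> where \<beta>: "\<beta> \<in> coR dual N trL p" "e = \<delta> (\<phi> \<beta>)"
    using assms(3) by (auto simp: coR_abs_def)
  obtain \<beta>' where \<beta>': "\<beta>' \<in> - N" "e = \<delta> (\<phi> \<beta>')" "\<beta>' \<in> R trT t"
    using acc \<open>e \<in> F\<close> unfolding ax_acc_def R_def by blast
  have "\<beta> \<in> - N"
    using \<beta> by (simp add: coR_def)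
  then have "\<phi> \<beta>' \<in> \<phi> ` coR dual N trL p"
    using abs \<beta> \<beta>' unfolding abstracts_def by (metis imageI)
  then obtain \<beta>'' where \<beta>'': "\<beta>'' \<in> coR dual N trL p" "\<phi> \<beta>' = \<phi> \<beta>''"
    by auto
  then have "\<beta>'' \<in> - N"
    by (simp add: coR_def)
  then have "\<beta>'' \<in> R trT t"
    using abs \<beta>' \<beta>'' unfolding abstracts_def by metis
  then show ?thesis
    using \<beta>'' by (auto simp: coR_def R_def can_do_def intro: comp_step.comm)
qed

text \<open>The offer condition on \<open>F\<close> is inherited along \<tau>-moves and along the
  trace, since stable derivatives of a successor are stable derivatives of \<open>p\<close>.\<close>

lemma passes_t_acc:
  assumes dual: "involutive dual" and M: "class_M dual N trL" and A: "class_A dual N trT"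
    and good: "good_preserved N trT good" and abs: "abstracts dual N \<phi> \<delta> trL trT"
    and gen: "ax_gen N trT good f" and acc: "ax_acc N \<phi> \<delta> trT good (f []) F"
    and "converges trL p s" "\<forall>q\<in>ws trL p s. coR_abs dual N \<phi> \<delta> trL q \<inter> F \<noteq> {}"
  shows "passes dual trL trT good (p, f (map dual s))"
proof -
  have boomerang: "Boomerang dual N trL"
    using M by (simp add: class_M_def)
  have f_tau: "\<exists>u. trT (f (\<beta> # r)) Tau u" if "\<beta> \<notin> N" for \<beta> r
    using gen that unfolding ax_gen_def can_do_def by (metis ComplI)
  have f_good: "good u" if "trT (f (\<beta> # r)) Tau u \<or> (\<exists>\<mu>. \<mu> \<noteq> \<beta> \<and> trT (f (\<beta> # r)) (Vis \<mu>) u)"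
    and "\<beta> \<notin> N" for \<beta> r u
    using gen that unfolding ax_gen_def by (metis ComplI)
  have f_next: "u = f r" if "trT (f (\<beta> # r)) (Vis \<beta>) u" "\<beta> \<notin> N" for \<beta> r u
    using gen that unfolding ax_gen_def by (metis ComplI)
  from assms(8,9) show ?thesis
  proof (induction rule: converges_induct)
    case (step p s)
    have tau: "passes dual trL trT good (q, f (map dual s))" if "trL p Tau q" for q
      using step.IH(1)[OF that] step.prems ws_tau[of trL p q s, OF that] by blast
    have vis: "passes dual trL trT good (q, f (map dual s'))"
      if "s = \<mu> # s'" "trL p (Vis \<mu>) q" for q \<mu> s'
      using step.IH(2)[OF that] step.prems ws_vis[of trL p \<mu> q s', OF that(2)] that(1) by blast
    show ?case
    proof (cases s)
      case Nil
      have "\<exists>c. comp_step dual trL trT (p, f []) c"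
      proof (cases "can_do trL p Tau")
        case True
        then show ?thesis
          by (auto simp: can_do_def intro: comp_step.left)
      next
        case False
        \<comment> \<open>A stable \<open>p\<close> is its own stable derivative, hence offers a
          label in \<open>F\<close>.\<close>
        then have "p \<in> ws trL p s"
          using Nil by (auto simp: ws_def intro: weak.refl)
        then show ?thesis
          using step.prems abstract_offer_synchronises[OF abs acc, of _ p] by fastforce
      qed
      moreover have "passes dual trL trT good c" if "comp_step dual trL trT (p, f []) c" for c
        using that
      proof (cases rule: comp_step.cases)
        case (left q)
        then show ?thesis using tau Nil by simp
      next
        case (right u)
        then show ?thesis using acc by (auto simp: ax_acc_def can_do_def)
      next
        case (comm \<nu> q u)
        then have "good u"
          using acc unfolding ax_acc_def can_do_def by (metis ComplI)
        then show ?thesis using comm by (simp add: passes.now)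
      qed
      ultimately show ?thesis
        using Nil by (auto intro: passes.later)
    next
      case (Cons \<mu> s')
      have \<mu>: "dual (dual \<mu>) = \<mu>"
        using dual by (simp add: involutive_def)
      let ?t = "f (dual \<mu> # map dual s')"
      have t: "trT ?t (Vis (dual \<mu>)) (f (map dual s'))"
        using gen by (simp add: ax_gen_def)
      show ?thesis
      proof (cases "dual \<mu> \<in> N")
        case True
        \<comment> \<open>For \<eta> = \<open>dual \<mu>\<close> the action received is \<mu>, so
          \<open>p'\<close> lies on the trace and passes the remaining test.\<close>
        obtain p' where p': "trL p (Vis \<mu>) p'" "trL p' (Vis (dual \<mu>)) p"
          using boomerang True \<mu> unfolding Boomerang_def by metis
        show ?thesis
          using passes_move_message[OF dual M A good True vis[OF Cons p'(1)] p'(2) t] Cons by simp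
      next
        case False
        \<comment> \<open>The test's own \<tau>-move provides progress; all its moves except
          \<open>dual \<mu>\<close> succeed at once.\<close>
        have "\<exists>c. comp_step dual trL trT (p, ?t) c"
          using f_tau[OF False] comp_step.right by metis
        moreover have "passes dual trL trT good c" if "comp_step dual trL trT (p, ?t) c" for c
          using that
        proof (cases rule: comp_step.cases)
          case (left q)
          then show ?thesis using tau Cons by simp
        next
          case (right u)
          then have "good u"
            using f_good False by blast
          then show ?thesis using right by (simp add: passes.now)
        next
          case (comm \<nu> q u)
          show ?thesis
          proof (cases "\<nu> = dual \<mu>")
            case True
            then have "u = f (map dual s')"
              using f_next False comm(3) by blast
            then show ?thesis using comm True \<mu> vis Cons by simp
          next
            case False
            then have "good u"
              using f_good \<open>dual \<mu> \<notin> N\<close> comm(3) by blast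
            then show ?thesis using comm by (simp add: passes.now)
          qed
        qed
        ultimately show ?thesis
          using Cons by (auto intro: passes.later)
      qed
    qed
  qed
qed

text \<open>This makes the set admissible for \<open>t_acc\<close>, whose axioms concern finite sets
  only.\<close>

lemma finite_Union_sem:
  assumes "finite_image tr" "finitary dual N \<phi> \<delta> tr" "converges tr p s"
  shows "finite (\<Union> (sem dual N \<phi> \<delta> tr p s))"
proof -
  have "finite (ws tr p s)"
    using finite_weak[OF assms(1,3)] by (simp add: ws_def)
  then show ?thesis
    using assms(2) by (auto simp: sem_def finitary_def)
qed

lemma Union_sem_subset:
  "label_abstraction N Y X \<phi> \<delta> \<Longrightarrow> \<Union> (sem dual N \<phi> \<delta> tr p s) \<subseteq> X"
  by (auto simp: sem_def coR_abs_def coR_def label_abstraction_def)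

theorem lemma23:
  fixes dual :: "'a::countable \<Rightarrow> 'a"
    and N :: "'a set"
    and trL :: "('p, 'a) lts"
    and trT :: "('t, 'a) lts"
    and good :: "'t \<Rightarrow> bool"
    and Y :: "'y set"
    and X :: "'x set"
    and \<phi> :: "'a \<Rightarrow> 'y"
    and \<delta> :: "'y \<Rightarrow> 'x"
    and t_cnv :: "'a list \<Rightarrow> 't"
    and t_acc :: "'a list \<Rightarrow> 'x set \<Rightarrow> 't"
    and p :: 'p
    and s :: "'a list"
    and E :: "'x set"
  assumes "involutive dual"
    and "class_M dual N trL"
    and "class_A dual N trT"
    and "good_preserved N trT good"
    and "label_abstraction N Y X \<phi> \<delta>"
    and "abstracts dual N \<phi> \<delta> trL trT"
    and "AxCmpl_witness N X \<phi> \<delta> trT good t_cnv t_acc"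
    and "finitary dual N \<phi> \<delta> trL"
    and "E \<subseteq> X"
    and "converges trL p s"
  shows "Must dual trL trT good p (t_acc (map dual s) (\<Union> (sem dual N \<phi> \<delta> trL p s) - E)) \<or>
    (\<exists>Rh \<in> sem dual N \<phi> \<delta> trL p s. Rh \<subseteq> E)"
proof (cases "\<exists>Rh \<in> sem dual N \<phi> \<delta> trL p s. Rh \<subseteq> E")
  case False
  let ?F = "\<Union> (sem dual N \<phi> \<delta> trL p s) - E"
  have "finite_image trL"
    using assms(2) by (simp add: class_M_def)
  then have "finite ?F"
    using finite_Union_sem assms(8,10) by (metis finite_Diff)
  moreover have "?F \<subseteq> X"
    by (rule subset_trans[OF Diff_subset Union_sem_subset[OF assms(5)]])
  ultimately have "ax_gen N trT good (\<lambda>s. t_acc s ?F)"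
    and "ax_acc N \<phi> \<delta> trT good (t_acc [] ?F) ?F"
    using assms(7) by (auto simp: AxCmpl_witness_def)
  \<comment> \<open>A member of the semantics not contained in \<open>E\<close> has an element
    outside \<open>E\<close>, which lies in the union.\<close>
  moreover have "\<forall>q\<in>ws trL p s. coR_abs dual N \<phi> \<delta> trL q \<inter> ?F \<noteq> {}"
    using False unfolding sem_def by blast
  ultimately have "passes dual trL trT good (p, t_acc (map dual s) ?F)"
    using passes_t_acc[OF assms(1-4,6), of "\<lambda>s. t_acc s ?F" ?F] assms(10) by blast
  then show ?thesis
    by (simp add: passes_imp_Must)
qed simp

end
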